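(* Let $u=(u_i)_{i\in\mathbb Z}$ be a real sequence and $N\ge 0$ an integer with $u_i=0$ for all $i\ge N$ and all $i\le -N$. Let $k\in\mathbb R$ and let $A$ be either $A(\gamma)$ or $A(\delta)$. The set of eigenvectors $\Phi$ (that is, $A\otimes\Phi=\Phi$) satisfying condition (A$\Phi$) is nonempty if and only if $$k=\min\Bigl(\max_{i}(u_{i-1}+u_i),\,1\Bigr).$$ In this case, it is the set of max-linear combinations of the critical columns of $A^*$, which can also be computed as the unique extensions (to vectors $\Phi$ on $\mathbb Z$ satisfying $A\otimes\Phi=\Phi$ and (A$\Phi$)) of the max-linear combinations, with the same coefficients, of the columns of $(A_{[-N-1,N+1]})^*$ with the same indices.
   Context: Max-plus conventions: on $\mathbb R\cup\{-\infty\}$, $a\oplus b=\max(a,b)$, $a\otimes b=a+b$, extended to matrices and vectors in the usual way. Vectors are indexed by $\mathbb Z$, and an eigenvector is a vector in $\mathbb R^{\mathbb Z}$ (since the matrices below have finite entries next to the diagonal, a solution of $A\otimes\Phi=\Phi$ that is not identically $-\infty$ automatically has only finite entries). For a real sequence $u$ and $k\in\mathbb R$ put $\gamma_i=\min(u_i,1-u_{i-1})$ and $\delta_i=\min(u_{i-1},1-u_i)$. The $\mathbb Z\times\mathbb Z$ matrix $A(\gamma)$ has entries $A(\gamma)_{i,i+1}=\gamma_i-k$, $A(\gamma)_{i,i-1}=\gamma_i$, and all other entries $-\infty$; $A(\delta)$ is defined in the same way with $\delta_i$ in place of $\gamma_i$. Thus $A(\gamma)\otimes\Phi=\Phi$ means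 $\max(\Phi_{i+1}+\gamma_i-k,\ \Phi_{i-1}+\gamma_i)=\Phi_i$ for all $i$. Condition (A$\Phi$): there exist arbitrarily large $N'$ and $N''$ with $\Phi_{N'}=\Phi_{N'+1}$ and $\Phi_{-N''-1}=\Phi_{-N''}-k$. The digraph of $A$ has nodes $\mathbb Z$ and edges $(i,j)$ with $A_{ij}\ne-\infty$, of weight $A_{ij}$; the weight of a path or cycle is the sum of the weights of its edges. All simple cycles have length two: $(i,i+1)$ denotes $i\to i+1\to i$. The critical cycles are the two-cycles with the greatest total weight, and the critical graph consists of all nodes and edges lying on critical cycles. The Kleene star is $A^*=I\oplus A\oplus A^2\oplus\cdots$, with $I$ the max-plus identity ($0$ on the diagonal, $-\infty$ elsewhere); $A^*_{ij}$, $i\ne j$, is the greatest weight of a path from $i$ to $j$. A critical column of $A^*$ is a column $A^*_{\cdot j}$ whose index $j$ is a node of the critical graph of $A$. $A_{[N_1,N_2]}$ is the finite submatrix of $A$ with row and column indices in the integer interval $[N_1,N_2]$. A vector $\Phi$ on $\mathbb Z$ is an extension of a vector $v$ on $[N_1,N_2]$ if $\Phi_i=v_i$ for all $i\in[N_1,N_2]$. A max-linear combination of vectors $w^{j}$ is a vector $\bigoplus_{j\in F}\alpha_j\otimes w^{j}$ with $F$ finite and nonempty and $\alpha_j\in\mathbb R$. *)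

theory Defs
  imports Complex_Main "HOL-Library.Extended_Real"
begin

text \<open>
  Max-plus arithmetic is carried by the type \<^typ>\<open>ereal\<close>: the sum is \<open>sup\<close>, the product is \<open>+\<close>.
  The value \<open>\<infinity>\<close> is not a max-plus scalar; it is never an entry of the matrices below, and
  appears only as the value of a supremum that diverges.
\<close>

type_synonym mp_vec = "int \<Rightarrow> ereal"
type_synonym mp_mat = "int \<Rightarrow> int \<Rightarrow> ereal"

definition mp_apply :: "mp_mat \<Rightarrow> mp_vec \<Rightarrow> mp_vec" where
  "mp_apply A x = (\<lambda>i. SUP j. A i j + x j)"

definition mp_mult :: "mp_mat \<Rightarrow> mp_mat \<Rightarrow> mp_mat" where
  "mp_mult A B = (\<lambda>i j. SUP l. A i l + B l j)"

definition mp_id :: mp_mat where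
  "mp_id = (\<lambda>i j. if i = j then 0 else - \<infinity>)"

primrec mp_power :: "mp_mat \<Rightarrow> nat \<Rightarrow> mp_mat" where
  "mp_power A 0 = mp_id"
| "mp_power A (Suc n) = mp_mult A (mp_power A n)"

definition kleene_star :: "mp_mat \<Rightarrow> mp_mat" where
  "kleene_star A = (\<lambda>i j. SUP n. mp_power A n i j)"

text \<open>
  The finite submatrix on \<open>[N1, N2]\<close> is padded with \<open>- \<infinity>\<close>. No path of finite weight
  then leaves the interval, so on indices in \<open>[N1, N2]\<close> the Kleene star of the padded
  matrix is the Kleene star of the finite submatrix.
\<close>

definition mp_submatrix :: "mp_mat \<Rightarrow> int \<Rightarrow> int \<Rightarrow> mp_mat" where
  "mp_submatrix A N1 N2 =
     (\<lambda>i j. if i \<in> {N1..N2} \<and> j \<in> {N1..N2} then A i j else - \<infinity>)"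

definition extends_on :: "mp_vec \<Rightarrow> mp_vec \<Rightarrow> int \<Rightarrow> int \<Rightarrow> bool" where
  "extends_on \<Phi> v N1 N2 \<longleftrightarrow> (\<forall>i\<in>{N1..N2}. \<Phi> i = v i)"

text \<open>The vectors being combined are the columns of \<open>W\<close> with index in \<open>F\<close>.\<close>

definition col_comb :: "mp_mat \<Rightarrow> int set \<Rightarrow> (int \<Rightarrow> real) \<Rightarrow> mp_vec" where
  "col_comb W F \<alpha> = (\<lambda>i. SUP j\<in>F. ereal (\<alpha> j) + W i j)"

definition max_lin_combs :: "mp_mat \<Rightarrow> int set \<Rightarrow> mp_vec set" where
  "max_lin_combs W S = {col_comb W F \<alpha> |F \<alpha>. finite F \<and> F \<noteq> {} \<and> F \<subseteq> S}"

definition edges :: "mp_mat \<Rightarrow> (int \<times> int) set" where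
  "edges A = {(i, j). A i j \<noteq> - \<infinity>}"

text \<open>The two-cycle \<open>i \<rightarrow> i + 1 \<rightarrow> i\<close> is represented by \<open>i\<close>.\<close>

definition two_cycle :: "mp_mat \<Rightarrow> int \<Rightarrow> bool" where
  "two_cycle A i \<longleftrightarrow> (i, i + 1) \<in> edges A \<and> (i + 1, i) \<in> edges A"

definition cycle_weight :: "mp_mat \<Rightarrow> int \<Rightarrow> ereal" where
  "cycle_weight A i = A i (i + 1) + A (i + 1) i"

definition critical_cycle :: "mp_mat \<Rightarrow> int \<Rightarrow> bool" where
  "critical_cycle A i \<longleftrightarrow>
     two_cycle A i \<and> (\<forall>l. two_cycle A l \<longrightarrow> cycle_weight A l \<le> cycle_weight A i)"

definition critical_nodes :: "mp_mat \<Rightarrow> int set" where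
  "critical_nodes A = {j. \<exists>i. critical_cycle A i \<and> (j = i \<or> j = i + 1)}"

definition gam :: "(int \<Rightarrow> real) \<Rightarrow> int \<Rightarrow> real" where
  "gam u i = min (u i) (1 - u (i - 1))"

definition del :: "(int \<Rightarrow> real) \<Rightarrow> int \<Rightarrow> real" where
  "del u i = min (u (i - 1)) (1 - u i)"

definition Amat :: "real \<Rightarrow> (int \<Rightarrow> real) \<Rightarrow> mp_mat" where
  "Amat k g = (\<lambda>i j. if j = i + 1 then ereal (g i - k)
                     else if j = i - 1 then ereal (g i)
                     else - \<infinity>)"

lemma mp_apply_Amat:
  "mp_apply (Amat k g) (\<lambda>j. ereal (\<Phi> j)) i
     = ereal (max (\<Phi> (i + 1) + g i - k) (\<Phi> (i - 1) + g i))"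
proof -
  have "(SUP j. Amat k g i j + ereal (\<Phi> j))
      = max (Amat k g i (i + 1) + ereal (\<Phi> (i + 1))) (Amat k g i (i - 1) + ereal (\<Phi> (i - 1)))"
  proof (rule antisym)
    show "(SUP j. Amat k g i j + ereal (\<Phi> j)) \<le> max (Amat k g i (i + 1) + ereal (\<Phi> (i + 1)))
        (Amat k g i (i - 1) + ereal (\<Phi> (i - 1)))"
      by (rule SUP_least) (auto simp: Amat_def)
  next
    show "max (Amat k g i (i + 1) + ereal (\<Phi> (i + 1))) (Amat k g i (i - 1) + ereal (\<Phi> (i - 1)))
        \<le> (SUP j. Amat k g i j + ereal (\<Phi> j))"
      by (intro max.boundedI; rule SUP_upper; simp)
  qed
  then show ?thesis
    by (simp add: mp_apply_def Amat_def algebra_simps)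
qed

definition cond_APhi :: "real \<Rightarrow> mp_vec \<Rightarrow> bool" where
  "cond_APhi k \<Phi> \<longleftrightarrow>
     (\<forall>M. \<exists>N'\<ge>M. \<Phi> N' = \<Phi> (N' + 1)) \<and>
     (\<forall>M. \<exists>N''\<ge>M. \<Phi> (- N'' - 1) = \<Phi> (- N'') - ereal k)"

definition eigenvector :: "mp_mat \<Rightarrow> mp_vec \<Rightarrow> bool" where
  "eigenvector A \<Phi> \<longleftrightarrow> (\<forall>i. \<bar>\<Phi> i\<bar> \<noteq> \<infinity>) \<and> mp_apply A \<Phi> = \<Phi>"

definition APhi_eigenvectors :: "real \<Rightarrow> mp_mat \<Rightarrow> mp_vec set" where
  "APhi_eigenvectors k A = {\<Phi>. eigenvector A \<Phi> \<and> cond_APhi k \<Phi>}"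

end

theory Submission
  imports Defs
begin

text \<open>
  Both matrices have the form \<^term>\<open>Amat k g\<close> with \<open>g\<close> of finite support, and the greatest
  value of \<open>g i + g (i + 1)\<close> is \<open>min (max\<^sub>i (u (i - 1) + u i)) 1\<close>: it is attained where
  \<open>u (i - 1) + u i\<close> crosses the level \<open>1\<close> if it ever exceeds it.
  A two-cycle of positive weight excludes eigenvectors. If all two-cycles have negative weight,
  then a node whose maximum is attained at its right neighbour passes this property on to that
  neighbour; the left half of (A\<open>\<Phi>\<close>) provides such a node, the right half forbids it far right.
  If the greatest cycle weight is \<open>0\<close>, straight paths are optimal, so that the Kleene star is
  explicit and a straight path never leaves an interval containing its ends. Following, from a
  node \<open>i\<close>, the neighbour attaining the maximum leads to a critical node \<open>j\<close> with
  \<open>\<Phi> i = A\<^sup>*\<^sub>i\<^sub>j + \<Phi> j\<close>. Outside \<open>[-N-1, N+1]\<close> condition (A\<open>\<Phi>\<close>) makes \<open>\<Phi>\<close> constant on the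
  right and of slope \<open>k\<close> on the left, whence uniqueness of extensions.
\<close>

section \<open>Weights of straight paths\<close>

text \<open>Each edge weight is charged to the node where the edge starts, so both sums include
  \<open>i\<close> and omit \<open>j\<close>.\<close>

definition path_weight :: "real \<Rightarrow> (int \<Rightarrow> real) \<Rightarrow> int \<Rightarrow> int \<Rightarrow> real" where
  "path_weight k g i j = (if j \<le> i then (\<Sum>l\<in>{j<..i}. g l) else (\<Sum>l\<in>{i..<j}. g l - k))"

lemma path_weight_self [simp]: "path_weight k g j j = 0"
  by (simp add: path_weight_def)

lemma path_weight_left:
  assumes "j < i"
  shows "path_weight k g i j = g i + path_weight k g (i - 1) j"
proof -
  have "{j<..i} = insert i {j<..i - 1}" using assms by auto
  then show ?thesis using assms by (simp add: path_weight_def)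
qed

lemma path_weight_right:
  assumes "i < j"
  shows "path_weight k g i j = g i - k + path_weight k g (i + 1) j"
proof -
  have "{i..<j} = insert i {i + 1..<j}" using assms by auto
  then show ?thesis using assms by (simp add: path_weight_def)
qed

section \<open>Reduction to real sequences\<close>

definition maxplus_eigen :: "real \<Rightarrow> (int \<Rightarrow> real) \<Rightarrow> (int \<Rightarrow> real) \<Rightarrow> bool" where
  "maxplus_eigen k g \<phi> \<longleftrightarrow> (\<forall>i. \<phi> i = max (\<phi> (i + 1) + g i - k) (\<phi> (i - 1) + g i))"

definition tail_cond :: "real \<Rightarrow> (int \<Rightarrow> real) \<Rightarrow> bool" where
  "tail_cond k \<phi> \<longleftrightarrow> (\<forall>M. \<exists>n\<ge>M. \<phi> n = \<phi> (n + 1)) \<and> (\<forall>M. \<exists>n\<ge>M. \<phi> (- n - 1) = \<phi> (- n) - k)"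

text \<open>Eigenvectors have finite entries by definition, so everything that follows can be done
  in real arithmetic.\<close>

lemma APhi_eigenvectors_Amat:
  "APhi_eigenvectors k (Amat k g)
     = {\<lambda>i. ereal (\<phi> i) |\<phi>. maxplus_eigen k g \<phi> \<and> tail_cond k \<phi>}"
proof -
  have "eigenvector (Amat k g) (\<lambda>i. ereal (\<phi> i)) \<longleftrightarrow> maxplus_eigen k g \<phi>" for \<phi>
    unfolding eigenvector_def maxplus_eigen_def fun_eq_iff mp_apply_Amat ereal.inject
    by (auto simp: eq_commute[of "\<phi> _"])
  moreover have "cond_APhi k (\<lambda>i. ereal (\<phi> i)) \<longleftrightarrow> tail_cond k \<phi>" for \<phi>
    by (simp add: cond_APhi_def tail_cond_def)
  ultimately have *: "(\<lambda>i. ereal (\<phi> i)) \<in> APhi_eigenvectors k (Amat k g)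
      \<longleftrightarrow> maxplus_eigen k g \<phi> \<and> tail_cond k \<phi>" for \<phi>
    by (simp add: APhi_eigenvectors_def)
  have "\<exists>\<phi>. \<Phi> = (\<lambda>i. ereal (\<phi> i))" if "\<Phi> \<in> APhi_eigenvectors k (Amat k g)" for \<Phi>
  proof -
    have "\<Phi> i = ereal (real_of_ereal (\<Phi> i))" for i
      using that by (simp add: APhi_eigenvectors_def eigenvector_def ereal_real)
    then show ?thesis by (intro exI[of _ "\<lambda>i. real_of_ereal (\<Phi> i)"] ext)
  qed
  with * show ?thesis by blast
qed

lemma maxplus_eigenD:
  assumes "maxplus_eigen k g \<phi>"
  shows "\<phi> i \<ge> \<phi> (i + 1) + g i - k" "\<phi> i \<ge> \<phi> (i - 1) + g i"
    "\<phi> i = \<phi> (i + 1) + g i - k \<or> \<phi> i = \<phi> (i - 1) + g i"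
  using assms[unfolded maxplus_eigen_def, rule_format, of i] by (auto simp: max_def split: if_splits)

section \<open>Tails of eigenvectors under (A\<Phi>)\<close>

text \<open>The bounds are asymmetric because \<open>gam u i\<close> and \<open>del u i\<close>
  involve \<open>u (i - 1)\<close> and \<open>u i\<close>: at \<open>i = -N\<close> both vanish,
  while at \<open>i = N\<close> only \<open>u i\<close> is sure to.\<close>

locale finite_support_weight =
  fixes k :: real and g :: "int \<Rightarrow> real" and N :: int
  assumes N_nonneg: "0 \<le> N"
    and g_right: "N < i \<Longrightarrow> g i = 0"
    and g_left: "i \<le> -N \<Longrightarrow> g i = 0"
begin

text \<open>Right of \<open>N\<close> the sequence is nondecreasing. A strict increase forces
  \<open>k > 0\<close>; the larger value cannot come from the left, so it comes from the right,
  which is a strict increase again. Equal neighbours would then never recur.\<close>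

lemma eigen_right_tail_step:
  assumes e: "maxplus_eigen k g \<phi>" and t: "tail_cond k \<phi>" and i: "N < i"
  shows "\<phi> (i + 1) = \<phi> i"
proof (rule ccontr)
  assume "\<phi> (i + 1) \<noteq> \<phi> i"
  moreover have "\<phi> (i + 1) \<ge> \<phi> i" "\<phi> i \<ge> \<phi> (i + 1) - k"
    using maxplus_eigenD(2)[OF e, of "i + 1"] maxplus_eigenD(1)[OF e, of i] i by (auto simp: g_right)
  ultimately have gt: "\<phi> (i + 1) > \<phi> i" and k: "k > 0" by auto
  have "\<phi> (j + 1) > \<phi> j" if "i \<le> j" for j
    using that
  proof (induction j rule: int_ge_induct)
    case base then show ?case by (rule gt)
  next
    case (step j)
    then have "g (j + 1) = 0" using i by (auto intro: g_right)
    with maxplus_eigenD(3)[OF e, of "j + 1"] step k show ?case by auto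
  qed
  moreover obtain n where "n \<ge> i" "\<phi> n = \<phi> (n + 1)" using t unfolding tail_cond_def by blast
  ultimately show False by fastforce
qed

text \<open>Mirror image: a value above the slope \<open>k\<close> cannot come from its right
  neighbour, so it equals its left neighbour, which for \<open>k > 0\<close> breaks the slope
  again.\<close>

lemma eigen_left_tail_step:
  assumes e: "maxplus_eigen k g \<phi>" and t: "tail_cond k \<phi>" and i: "i \<le> -N"
  shows "\<phi> (i - 1) = \<phi> i - k"
proof (rule ccontr)
  assume "\<phi> (i - 1) \<noteq> \<phi> i - k"
  moreover have "\<phi> (i - 1) \<ge> \<phi> i - k" "\<phi> (i - 1) \<le> \<phi> i"
    using maxplus_eigenD(1)[OF e, of "i - 1"] maxplus_eigenD(2)[OF e, of i] i by (auto simp: g_left)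
  ultimately have gt: "\<phi> (i - 1) > \<phi> i - k" and k: "k > 0" by auto
  have "\<phi> (j - 1) > \<phi> j - k" if "j \<le> i" for j
    using that
  proof (induction j rule: int_le_induct)
    case base then show ?case by (rule gt)
  next
    case (step j)
    then have "g (j - 1) = 0" using i by (auto intro: g_left)
    with maxplus_eigenD(3)[OF e, of "j - 1"] step k show ?case by auto
  qed
  moreover obtain n where "n \<ge> -i" "\<phi> (- n - 1) = \<phi> (- n) - k"
    using t unfolding tail_cond_def by blast
  ultimately show False by (metis less_irrefl minus_le_iff)
qed

lemma eigen_right_tail:
  assumes "maxplus_eigen k g \<phi>" "tail_cond k \<phi>" "N + 1 \<le> i"
  shows "\<phi> i = \<phi> (N + 1)"
  using assms(3)
  by (induction i rule: int_ge_induct) (auto simp: eigen_right_tail_step[OF assms(1,2)])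

lemma eigen_left_tail:
  assumes "maxplus_eigen k g \<phi>" "tail_cond k \<phi>" "i \<le> -N - 1"
  shows "\<phi> i = \<phi> (-N - 1) + of_int (i + N + 1) * k"
  using assms(3)
  by (induction i rule: int_le_induct)
     (auto simp: eigen_left_tail_step[OF assms(1,2)] algebra_simps)

lemma eigen_eqI:
  assumes \<phi>: "maxplus_eigen k g \<phi>" "tail_cond k \<phi>" and \<psi>: "maxplus_eigen k g \<psi>" "tail_cond k \<psi>"
    and eq: "\<And>i. i \<in> {-N - 1..N + 1} \<Longrightarrow> \<phi> i = \<psi> i"
  shows "\<phi> = \<psi>"
proof
  fix i
  consider "i \<in> {-N - 1..N + 1}" | "N + 1 \<le> i" | "i \<le> -N - 1" by fastforce
  then show "\<phi> i = \<psi> i"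
  proof cases
    case 1 then show ?thesis by (rule eq)
  next
    case 2
    then show ?thesis
      using eigen_right_tail[OF \<phi> 2] eigen_right_tail[OF \<psi> 2] eq[of "N + 1"] N_nonneg by simp
  next
    case 3
    then show ?thesis
      using eigen_left_tail[OF \<phi> 3] eigen_left_tail[OF \<psi> 3] eq[of "-N - 1"] N_nonneg by simp
  qed
qed

section \<open>Cycle weights forced by an eigenvector\<close>

lemma eigen_cycle_le:
  assumes "maxplus_eigen k g \<phi>"
  shows "g i + g (i + 1) \<le> k"
  using maxplus_eigenD(1)[OF assms, of i] maxplus_eigenD(2)[OF assms, of "i + 1"] by simp

lemma eigen_cycle_attained:
  assumes e: "maxplus_eigen k g \<phi>" and t: "tail_cond k \<phi>"
  shows "\<exists>i. g i + g (i + 1) = k"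
proof (rule ccontr)
  assume "\<not> ?thesis"
  then have less: "g i + g (i + 1) < k" for i
    using eigen_cycle_le[OF e, of i] by (meson less_eq_real_def)
  have k: "k > 0" using less[of "N + 1"] by (simp add: g_right)
  \<comment> \<open>Were the maximum at \<open>i + 1\<close> attained on the left, the two equations
    would add up to a two-cycle of weight 0.\<close>
  have next_right: "\<phi> (i + 1) = \<phi> (i + 2) + g (i + 1) - k" if "\<phi> i = \<phi> (i + 1) + g i - k" for i
    using that less[of i] maxplus_eigenD(3)[OF e, of "i + 1"] by (auto simp: add.commute)
  have right: "\<phi> j = \<phi> (j + 1) + g j - k" if i: "\<phi> i = \<phi> (i + 1) + g i - k" and "i \<le> j" for i j
    using that(2)
  proof (induction j rule: int_ge_induct)
    case base then show ?case by (rule i)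
  next
    case (step j) then show ?case using next_right[of j] by (simp add: algebra_simps)
  qed
  \<comment> \<open>The slope of the left tail gives the starting node; the equation propagated to
    \<open>N + 1\<close> contradicts the constant right tail, since \<open>k > 0\<close>.\<close>
  have i: "\<phi> (-N - 1) = \<phi> (-N - 1 + 1) + g (-N - 1) - k"
    using eigen_left_tail_step[OF e t, of "-N"] by (simp add: g_left)
  show False
    using right[OF i, of "N + 1"] eigen_right_tail_step[OF e t, of "N + 1"] k N_nonneg
    by (simp add: g_right)
qed

end

lemma Amat_le: "Amat k g i l + ereal (f l) \<le> ereal (max (f (i + 1) + g i - k) (f (i - 1) + g i))"
  by (auto simp: Amat_def max_def)

section \<open>Straight paths when the greatest cycle weight is 0\<close>

text \<open>The two-cycle at \<open>i\<close> weighs \<open>g i + g (i + 1) - k\<close>, so the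
  greatest cycle weight is 0 and the critical cycles are those of weight 0.\<close>

locale critical_weight = finite_support_weight +
  assumes cycle_le: "g i + g (i + 1) \<le> k"
    and cycle_attained: "\<exists>i. g i + g (i + 1) = k"
begin

lemma critical_nodes_Amat:
  "critical_nodes (Amat k g) = {j. g j + g (j + 1) = k \<or> g (j - 1) + g j = k}"
proof -
  have two: "two_cycle (Amat k g) i" for i
    by (simp add: two_cycle_def edges_def Amat_def)
  have weight: "cycle_weight (Amat k g) i = ereal (g i + g (i + 1) - k)" for i
    by (simp add: cycle_weight_def Amat_def)
  obtain m where m: "g m + g (m + 1) = k" using cycle_attained by blast
  have "critical_cycle (Amat k g) i \<longleftrightarrow> g i + g (i + 1) = k" for i
  proof
    assume "critical_cycle (Amat k g) i"
    then have "cycle_weight (Amat k g) m \<le> cycle_weight (Amat k g) i"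
      using two by (simp add: critical_cycle_def)
    then show "g i + g (i + 1) = k" using m cycle_le[of i] by (simp add: weight)
  next
    assume "g i + g (i + 1) = k"
    then show "critical_cycle (Amat k g) i"
      using two cycle_le by (simp add: critical_cycle_def weight)
  qed
  moreover have "(\<exists>i. P i \<and> (j = i \<or> j = i + 1)) \<longleftrightarrow> P j \<or> P (j - 1)" for P and j :: int
    by (metis add_diff_cancel_right' diff_add_cancel)
  ultimately show ?thesis by (simp add: critical_nodes_def)
qed

text \<open>If \<open>i \<le> j\<close>, the step to the left must be undone, and this detour is a
  two-cycle of nonpositive weight.\<close>

lemma path_weight_left_le: "g i + path_weight k g (i - 1) j \<le> path_weight k g i j"
proof (cases "j < i")
  case True then show ?thesis by (simp add: path_weight_left)
next
  case False
  then have "path_weight k g (i - 1) j = g (i - 1) - k + path_weight k g i j"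
    using path_weight_right[of "i - 1" j k g] by simp
  then show ?thesis using cycle_le[of "i - 1"] by simp
qed

lemma path_weight_right_le: "path_weight k g (i + 1) j + g i - k \<le> path_weight k g i j"
proof (cases "i < j")
  case True then show ?thesis by (simp add: path_weight_right)
next
  case False
  then have "path_weight k g (i + 1) j = g (i + 1) + path_weight k g i j"
    using path_weight_left[of j "i + 1" k g] by simp
  then show ?thesis using cycle_le[of i] by simp
qed

text \<open>For \<open>i \<noteq> j\<close> the first step of the straight path attains the maximum;
  at \<open>i = j\<close> a critical two-cycle leads out and back at weight 0.\<close>

lemma path_weight_critical_eigen:
  assumes "j \<in> critical_nodes (Amat k g)"
  shows "maxplus_eigen k g (\<lambda>i. path_weight k g i j)"
proof -
  have "path_weight k g i j = path_weight k g (i + 1) j + g i - k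
      \<or> path_weight k g i j = path_weight k g (i - 1) j + g i" for i
    using assms path_weight_left[of j i k g] path_weight_right[of i j k g]
      path_weight_left[of i "i + 1" k g] path_weight_right[of "i - 1" i k g]
    by (cases i j rule: linorder_cases) (auto simp: critical_nodes_Amat)
  then show ?thesis
    unfolding maxplus_eigen_def
    using path_weight_left_le[of _ j] path_weight_right_le[of _ j]
    by (smt (verit))
qed

lemma eigen_path_weight_le:
  assumes "maxplus_eigen k g \<phi>"
  shows "path_weight k g i j + \<phi> j \<le> \<phi> i"
proof (cases "j \<le> i")
  case True
  then show ?thesis
  proof (induction i rule: int_ge_induct)
    case (step i)
    then show ?case
      using path_weight_left[of j "i + 1" k g] maxplus_eigenD(2)[OF assms, of "i + 1"] by simp
  qed simp
next
  case False
  then have "i \<le> j" by simp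
  then show ?thesis
  proof (induction i rule: int_le_induct)
    case (step i)
    then show ?case
      using path_weight_right[of "i - 1" j k g] maxplus_eigenD(1)[OF assms, of "i - 1"] by simp
  qed simp
qed

section \<open>Tracing attained maxima to critical nodes\<close>

text \<open>Either the two-cycle with the right neighbour is critical and the walk stops at once, or
  the neighbour's maximum is again attained on its right. If the walk reaches \<open>N + 1\<close>,
  the constant tail forces \<open>k = 0\<close>, which makes \<open>N + 1\<close> critical.\<close>

lemma eigen_path_to_right:
  assumes e: "maxplus_eigen k g \<phi>" and t: "tail_cond k \<phi>"
    and "i \<le> N + 1" "\<phi> i = \<phi> (i + 1) + g i - k"
  shows "\<exists>j\<in>{i..N + 1} \<inter> critical_nodes (Amat k g). \<phi> i = path_weight k g i j + \<phi> j"
  using assms(3,4)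
proof (induction i rule: int_le_induct)
  case base
  then have "k = 0" using eigen_right_tail_step[OF e t, of "N + 1"] by (simp add: g_right)
  then have "N + 1 \<in> critical_nodes (Amat k g)" unfolding critical_nodes_Amat by (simp add: g_right)
  then show ?case by force
next
  case (step i)
  show ?case
  proof (cases "g (i - 1) + g i = k")
    case True
    then have "i - 1 \<in> critical_nodes (Amat k g)" by (simp add: critical_nodes_Amat)
    then show ?thesis using step.hyps by (intro bexI[of _ "i - 1"]) auto
  next
    case False
    then have "\<phi> i = \<phi> (i + 1) + g i - k"
      using step.prems maxplus_eigenD(3)[OF e, of i] by auto
    with step.IH obtain j where j: "j \<in> {i..N + 1} \<inter> critical_nodes (Amat k g)"
      "\<phi> i = path_weight k g i j + \<phi> j" by blast
    then have "\<phi> (i - 1) = path_weight k g (i - 1) j + \<phi> j"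
      using path_weight_right[of "i - 1" j k g] step.prems by simp
    then show ?thesis using j(1) by (intro bexI[of _ j]) auto
  qed
qed

text \<open>Mirror image; at \<open>-N - 1\<close> an attained left neighbour against the slope
  \<open>k\<close> of the tail forces \<open>k = 0\<close>.\<close>

lemma eigen_path_to_left:
  assumes e: "maxplus_eigen k g \<phi>" and t: "tail_cond k \<phi>"
    and "-N - 1 \<le> i" "\<phi> i = \<phi> (i - 1) + g i"
  shows "\<exists>j\<in>{-N - 1..i} \<inter> critical_nodes (Amat k g). \<phi> i = path_weight k g i j + \<phi> j"
  using assms(3,4)
proof (induction i rule: int_ge_induct)
  case base
  then have "k = 0" using eigen_left_tail_step[OF e t, of "-N - 1"] by (simp add: g_left)
  then have "-N - 1 \<in> critical_nodes (Amat k g)" unfolding critical_nodes_Amat by (simp add: g_left)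
  then show ?case by force
next
  case (step i)
  show ?case
  proof (cases "g i + g (i + 1) = k")
    case True
    then have "i + 1 \<in> critical_nodes (Amat k g)" by (simp add: critical_nodes_Amat)
    then show ?thesis using step.hyps by (intro bexI[of _ "i + 1"]) auto
  next
    case False
    then have "\<phi> i = \<phi> (i - 1) + g i"
      using step.prems maxplus_eigenD(3)[OF e, of i] by auto
    with step.IH obtain j where j: "j \<in> {-N - 1..i} \<inter> critical_nodes (Amat k g)"
      "\<phi> i = path_weight k g i j + \<phi> j" by blast
    then have "\<phi> (i + 1) = path_weight k g (i + 1) j + \<phi> j"
      using path_weight_left[of j "i + 1" k g] step.prems by simp
    then show ?thesis using j(1) by (intro bexI[of _ j]) auto
  qed
qed

lemma eigen_path_to_critical:
  assumes "maxplus_eigen k g \<phi>" "tail_cond k \<phi>" "i \<in> {-N - 1..N + 1}"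
  shows "\<exists>j\<in>critical_nodes (Amat k g) \<inter> {-N - 1..N + 1}. \<phi> i = path_weight k g i j + \<phi> j"
  using maxplus_eigenD(3)[OF assms(1), of i] eigen_path_to_right[OF assms(1,2), of i]
    eigen_path_to_left[OF assms(1,2), of i] assms(3) by force

section \<open>The Kleene star\<close>

text \<open>The bounds on \<open>B\<close> cover both the whole matrix and its submatrix on \<open>[a, b]\<close>.\<close>

lemma kleene_star_eq_path_weight:
  assumes le: "\<And>i l. B i l \<le> Amat k g i l"
    and eq: "\<And>i l. i \<in> {a..b} \<Longrightarrow> l \<in> {a..b} \<Longrightarrow> B i l = Amat k g i l"
    and ij: "i \<in> {a..b}" "j \<in> {a..b}"
  shows "kleene_star B i j = ereal (path_weight k g i j)"
proof (rule antisym)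
  \<comment> \<open>Whatever the first edge, continuing straight to \<open>j\<close> afterwards does
    not beat the straight path.\<close>
  have "mp_power B n i j \<le> ereal (path_weight k g i j)" for n i
  proof (induction n arbitrary: i)
    case 0
    then show ?case by (simp add: mp_id_def)
  next
    case (Suc n)
    have "B i l + mp_power B n l j \<le> ereal (path_weight k g i j)" for l
    proof -
      have "B i l + mp_power B n l j \<le> Amat k g i l + ereal (path_weight k g l j)"
        by (intro add_mono le Suc)
      also have "\<dots> \<le> ereal (max (path_weight k g (i + 1) j + g i - k)
          (path_weight k g (i - 1) j + g i))"
        by (rule Amat_le)
      also have "\<dots> \<le> ereal (path_weight k g i j)"
        using path_weight_left_le[of i j] path_weight_right_le[of i j] by simp
      finally show ?thesis .
    qed
    then show ?case by (simp add: mp_mult_def SUP_least)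
  qed
  then show "kleene_star B i j \<le> ereal (path_weight k g i j)"
    by (simp add: kleene_star_def SUP_least)
next
  \<comment> \<open>The straight path has \<open>\<bar>i - j\<bar>\<close> edges, so that power
    already contains its weight; its nodes stay in \<open>{a..b}\<close>, where \<open>B\<close>
    agrees with the full matrix.\<close>
  have "ereal (path_weight k g i j) \<le> mp_power B n i j"
    if "i \<in> {a..b}" "\<bar>i - j\<bar> = int n" for n i
    using that
  proof (induction n arbitrary: i)
    case 0
    then show ?case by (simp add: mp_id_def)
  next
    case (Suc n)
    define l where "l = (if i < j then i + 1 else i - 1)"
    have l: "l \<in> {a..b}" "\<bar>l - j\<bar> = int n" using Suc.prems ij by (auto simp: l_def)
    have "ereal (path_weight k g i j) = Amat k g i l + ereal (path_weight k g l j)"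
      using path_weight_left[of j i k g] path_weight_right[of i j k g] Suc.prems(2)
      by (auto simp: l_def Amat_def)
    also have "\<dots> \<le> B i l + mp_power B n l j"
      using eq[OF Suc.prems(1) l(1)] Suc.IH[OF l] by (simp add: add_mono)
    also have "\<dots> \<le> mp_power B (Suc n) i j"
      by (auto simp: mp_mult_def intro: SUP_upper)
    finally show ?case .
  qed
  from this[OF ij(1), of "nat \<bar>i - j\<bar>"]
  show "ereal (path_weight k g i j) \<le> kleene_star B i j"
    unfolding kleene_star_def by (auto intro: SUP_upper2)
qed

lemma kleene_star_Amat: "kleene_star (Amat k g) i j = ereal (path_weight k g i j)"
  by (rule kleene_star_eq_path_weight[of _ "min i j" "max i j"]) auto

lemma kleene_star_submatrix_Amat:
  assumes "i \<in> {a..b}" "j \<in> {a..b}"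
  shows "kleene_star (mp_submatrix (Amat k g) a b) i j = ereal (path_weight k g i j)"
  using assms by (intro kleene_star_eq_path_weight[of _ a b]) (auto simp: mp_submatrix_def)

section \<open>Max-linear combinations of columns\<close>

definition comb :: "int set \<Rightarrow> (int \<Rightarrow> real) \<Rightarrow> int \<Rightarrow> real" where
  "comb F \<alpha> i = Max ((\<lambda>j. \<alpha> j + path_weight k g i j) ` F)"

text \<open>\<open>W\<close> is constrained in row \<open>i\<close> only, so that the lemma serves
  both the full matrix and the submatrix.\<close>

lemma col_comb_eq_comb:
  assumes "finite F" "F \<noteq> {}" "\<And>j. j \<in> F \<Longrightarrow> W i j = ereal (path_weight k g i j)"
  shows "col_comb W F \<alpha> i = ereal (comb F \<alpha> i)"
proof -
  have "col_comb W F \<alpha> i = (SUP j\<in>F. ereal (\<alpha> j + path_weight k g i j))"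
    unfolding col_comb_def using assms(3) by (intro SUP_cong) auto
  also have "\<dots> = ereal (comb F \<alpha> i)"
  proof (rule antisym)
    show "(SUP j\<in>F. ereal (\<alpha> j + path_weight k g i j)) \<le> ereal (comb F \<alpha> i)"
      unfolding comb_def using assms(1) by (intro SUP_least) auto
    have "comb F \<alpha> i \<in> (\<lambda>j. \<alpha> j + path_weight k g i j) ` F"
      unfolding comb_def using assms(1,2) by (intro Max_in) auto
    then show "ereal (comb F \<alpha> i) \<le> (SUP j\<in>F. ereal (\<alpha> j + path_weight k g i j))"
      by (auto intro: SUP_upper)
  qed
  finally show ?thesis .
qed

lemma comb_shift:
  assumes "finite F" "F \<noteq> {}" "\<And>j. j \<in> F \<Longrightarrow> path_weight k g i j = path_weight k g l j + c"
  shows "comb F \<alpha> i = comb F \<alpha> l + c"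
proof -
  have "comb F \<alpha> i = Max ((\<lambda>j. (\<alpha> j + path_weight k g l j) + c) ` F)"
    unfolding comb_def using assms(3) by (intro arg_cong[of _ _ Max] image_cong) auto
  then show ?thesis unfolding comb_def using Max_add_commute[OF assms(1,2)] by simp
qed

text \<open>Max-plus linearity: each relation is inherited from the column that realises the maximum
  at \<open>i + 1\<close>, \<open>i - 1\<close> or \<open>i\<close>.\<close>

lemma comb_eigen:
  assumes F: "finite F" "F \<noteq> {}" "F \<subseteq> critical_nodes (Amat k g)"
  shows "maxplus_eigen k g (comb F \<alpha>)"
  unfolding maxplus_eigen_def
proof
  fix i
  have ge: "\<alpha> j + path_weight k g i j \<le> comb F \<alpha> i" if "j \<in> F" for i j
    unfolding comb_def using that F(1) by (intro Max_ge) auto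
  have attained: "\<exists>j\<in>F. comb F \<alpha> i = \<alpha> j + path_weight k g i j" for i
  proof -
    have "comb F \<alpha> i \<in> (\<lambda>j. \<alpha> j + path_weight k g i j) ` F"
      unfolding comb_def using F by (intro Max_in) auto
    then show ?thesis by blast
  qed
  have eig: "maxplus_eigen k g (\<lambda>i. path_weight k g i j)" if "j \<in> F" for j
    using path_weight_critical_eigen that F(3) by blast
  have "comb F \<alpha> (i + 1) + g i - k \<le> comb F \<alpha> i"
    using attained[of "i + 1"] maxplus_eigenD(1)[OF eig, of _ i] ge[of _ i] by fastforce
  moreover have "comb F \<alpha> (i - 1) + g i \<le> comb F \<alpha> i"
    using attained[of "i - 1"] maxplus_eigenD(2)[OF eig, of _ i] ge[of _ i] by fastforce
  moreover have "comb F \<alpha> i \<le> max (comb F \<alpha> (i + 1) + g i - k) (comb F \<alpha> (i - 1) + g i)"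
    using attained[of i] maxplus_eigenD(3)[OF eig, of _ i] ge[of _ "i + 1"] ge[of _ "i - 1"]
    by (smt (verit))
  ultimately show "comb F \<alpha> i = max (comb F \<alpha> (i + 1) + g i - k) (comb F \<alpha> (i - 1) + g i)"
    by simp
qed

lemma comb_tail_cond:
  assumes F: "finite F" "F \<noteq> {}"
  shows "tail_cond k (comb F \<alpha>)"
  unfolding tail_cond_def
proof (intro conjI allI)
  fix M
  \<comment> \<open>Beyond \<open>N\<close> and all of \<open>F\<close>, every straight path from
    \<open>n + 1\<close> into \<open>F\<close> starts with a left step of weight 0.\<close>
  define n where "n = max M (max (N + 1) (Max F))"
  have j: "j \<le> n" if "j \<in> F" for j using that F by (simp add: n_def le_max_iff_disj)
  have "N < n + 1" by (auto simp: n_def)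
  then have "comb F \<alpha> (n + 1) = comb F \<alpha> n + 0"
    using j path_weight_left[of _ "n + 1" k g] by (intro comb_shift[OF F]) (fastforce simp: g_right)
  moreover have "n \<ge> M" by (simp add: n_def)
  ultimately show "\<exists>n\<ge>M. comb F \<alpha> n = comb F \<alpha> (n + 1)" by force
next
  fix M
  \<comment> \<open>Every straight path from \<open>- n - 1\<close> into \<open>F\<close> starts
    with a right step of weight \<open>- k\<close>.\<close>
  define n where "n = max M (max (N + 1) (- Min F))"
  have j: "- n \<le> j" if "j \<in> F" for j
    using Min_le[OF F(1) that] by (auto simp: n_def)
  have n: "- n - 1 \<le> - N" by (auto simp: n_def)
  have "comb F \<alpha> (- n - 1) = comb F \<alpha> (- n) + (- k)"
  proof (rule comb_shift[OF F])
    fix j assume "j \<in> F"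
    then show "path_weight k g (- n - 1) j = path_weight k g (- n) j + - k"
      using j[of j] path_weight_right[of "- n - 1" j k g] n by (simp add: g_left)
  qed
  moreover have "n \<ge> M" by (simp add: n_def)
  ultimately show "\<exists>n\<ge>M. comb F \<alpha> (- n - 1) = comb F \<alpha> (- n) - k" by force
qed

lemma col_comb_kleene_star:
  assumes "finite F" "F \<noteq> {}"
  shows "col_comb (kleene_star (Amat k g)) F \<alpha> = (\<lambda>i. ereal (comb F \<alpha> i))"
  using assms by (intro ext col_comb_eq_comb kleene_star_Amat)

lemma col_comb_in_APhi_eigenvectors:
  assumes "finite F" "F \<noteq> {}" "F \<subseteq> critical_nodes (Amat k g)"
  shows "col_comb (kleene_star (Amat k g)) F \<alpha> \<in> APhi_eigenvectors k (Amat k g)"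
  unfolding APhi_eigenvectors_Amat col_comb_kleene_star[OF assms(1,2)]
  using comb_eigen[OF assms] comb_tail_cond[OF assms(1,2)] by blast

section \<open>Extensions from the finite submatrix\<close>

lemma col_comb_submatrix:
  assumes "finite F" "F \<noteq> {}" "F \<subseteq> {a..b}" "i \<in> {a..b}"
  shows "col_comb (kleene_star (mp_submatrix (Amat k g) a b)) F \<alpha> i
    = col_comb (kleene_star (Amat k g)) F \<alpha> i"
  unfolding col_comb_kleene_star[OF assms(1,2)]
  using assms by (intro col_comb_eq_comb kleene_star_submatrix_Amat) auto

lemma APhi_eigenvector_eqI:
  assumes "\<Phi> \<in> APhi_eigenvectors k (Amat k g)" "\<Psi> \<in> APhi_eigenvectors k (Amat k g)"
    and "extends_on \<Phi> \<Psi> (-N - 1) (N + 1)"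
  shows "\<Phi> = \<Psi>"
  using assms unfolding APhi_eigenvectors_Amat extends_on_def by (auto dest: eigen_eqI)

text \<open>The singleton expresses existence and uniqueness of the extension, and that indices and
  coefficients are preserved.\<close>

lemma extension_of_col_comb:
  assumes F: "finite F" "F \<noteq> {}" "F \<subseteq> critical_nodes (Amat k g) \<inter> {-N - 1..N + 1}"
  shows "{\<Phi> \<in> APhi_eigenvectors k (Amat k g). extends_on \<Phi>
      (col_comb (kleene_star (mp_submatrix (Amat k g) (-N - 1) (N + 1))) F \<alpha>) (-N - 1) (N + 1)}
    = {col_comb (kleene_star (Amat k g)) F \<alpha>}"
proof -
  let ?v = "col_comb (kleene_star (mp_submatrix (Amat k g) (-N - 1) (N + 1))) F \<alpha>"
  let ?w = "col_comb (kleene_star (Amat k g)) F \<alpha>"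
  have "extends_on \<Phi> ?v (-N - 1) (N + 1) \<longleftrightarrow> extends_on \<Phi> ?w (-N - 1) (N + 1)" for \<Phi>
    using col_comb_submatrix[of F "-N - 1" "N + 1"] F by (simp add: extends_on_def)
  moreover have "?w \<in> APhi_eigenvectors k (Amat k g)"
    using col_comb_in_APhi_eigenvectors F by blast
  moreover have "extends_on ?w ?w (-N - 1) (N + 1)" by (simp add: extends_on_def)
  ultimately show ?thesis using APhi_eigenvector_eqI by blast
qed

lemma APhi_eigenvector_is_col_comb:
  assumes "\<Phi> \<in> APhi_eigenvectors k (Amat k g)"
  obtains F \<alpha> where "finite F" "F \<noteq> {}" "F \<subseteq> critical_nodes (Amat k g) \<inter> {-N - 1..N + 1}"
    "\<Phi> = col_comb (kleene_star (Amat k g)) F \<alpha>"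
proof -
  obtain \<phi> where \<Phi>: "\<Phi> = (\<lambda>i. ereal (\<phi> i))" and \<phi>: "maxplus_eigen k g \<phi>" "tail_cond k \<phi>"
    using assms by (auto simp: APhi_eigenvectors_Amat)
  \<comment> \<open>For \<open>k = 0\<close> there are infinitely many critical nodes; the
    restriction to the interval keeps \<open>F\<close> finite.\<close>
  define F where "F = critical_nodes (Amat k g) \<inter> {-N - 1..N + 1}"
  have fin: "finite F" by (simp add: F_def)
  have "0 \<in> {-N - 1..N + 1}" using N_nonneg by simp
  from eigen_path_to_critical[OF \<phi> this] have ne: "F \<noteq> {}" by (auto simp: F_def)
  \<comment> \<open>The coefficients are the values of \<open>\<phi>\<close> itself: no column then
    exceeds \<open>\<phi>\<close>, and a traced path gives equality on the interval.\<close>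
  have "\<phi> = comb F \<phi>"
  proof (rule eigen_eqI[OF \<phi>])
    show "maxplus_eigen k g (comb F \<phi>)" "tail_cond k (comb F \<phi>)"
      using fin ne by (auto intro: comb_eigen comb_tail_cond simp: F_def)
    fix i assume "i \<in> {-N - 1..N + 1}"
    from eigen_path_to_critical[OF \<phi> this]
    obtain j where "j \<in> F" "\<phi> i = path_weight k g i j + \<phi> j" by (auto simp: F_def)
    then show "\<phi> i = comb F \<phi> i"
      unfolding comb_def using fin eigen_path_weight_le[OF \<phi>(1), of i]
      by (intro Max_eqI[symmetric]) (auto simp: add.commute)
  qed
  then have "\<Phi> = col_comb (kleene_star (Amat k g)) F \<phi>"
    using \<Phi> col_comb_kleene_star[OF fin ne] by metis
  then show ?thesis using that fin ne F_def by blast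
qed

lemma APhi_eigenvectors_eq_max_lin_combs:
  "APhi_eigenvectors k (Amat k g)
     = max_lin_combs (kleene_star (Amat k g)) (critical_nodes (Amat k g))"
proof (intro equalityI subsetI)
  fix \<Phi> assume "\<Phi> \<in> APhi_eigenvectors k (Amat k g)"
  then show "\<Phi> \<in> max_lin_combs (kleene_star (Amat k g)) (critical_nodes (Amat k g))"
    by (rule APhi_eigenvector_is_col_comb) (auto simp: max_lin_combs_def)
qed (use col_comb_in_APhi_eigenvectors in \<open>force simp: max_lin_combs_def\<close>)

lemma APhi_eigenvectors_nonempty: "APhi_eigenvectors k (Amat k g) \<noteq> {}"
proof -
  obtain j where "g j + g (j + 1) = k" using cycle_attained by blast
  then have "{j} \<subseteq> critical_nodes (Amat k g)" by (simp add: critical_nodes_Amat)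
  then show ?thesis using col_comb_in_APhi_eigenvectors[of "{j}"] by auto
qed

text \<open>A critical cycle needs a node with \<open>g\<close> nonzero, so it meets the support.
  For \<open>k = 0\<close> all two-cycles far out are critical.\<close>

lemma critical_nodes_bounded:
  assumes "k \<noteq> 0"
  shows "critical_nodes (Amat k g) \<subseteq> {-N - 1..N + 1}"
proof
  fix j assume "j \<in> critical_nodes (Amat k g)"
  then have "g j + g (j + 1) \<noteq> 0 \<or> g (j - 1) + g j \<noteq> 0"
    using assms by (auto simp: critical_nodes_Amat)
  then show "j \<in> {-N - 1..N + 1}"
    using g_left[of j] g_left[of "j + 1"] g_left[of "j - 1"]
      g_right[of j] g_right[of "j + 1"] g_right[of "j - 1"] by fastforce
qed

lemma APhi_eigenvectors_as_extensions:
  "APhi_eigenvectors k (Amat k g) =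
     {\<Phi> \<in> APhi_eigenvectors k (Amat k g).
        \<exists>v \<in> max_lin_combs (kleene_star (mp_submatrix (Amat k g) (-N - 1) (N + 1)))
               (critical_nodes (Amat k g) \<inter> {-N - 1..N + 1}).
          extends_on \<Phi> v (-N - 1) (N + 1)}"
proof (intro equalityI subsetI CollectI conjI)
  fix \<Phi> assume "\<Phi> \<in> APhi_eigenvectors k (Amat k g)"
  then obtain F \<alpha> where F: "finite F" "F \<noteq> {}"
    "F \<subseteq> critical_nodes (Amat k g) \<inter> {-N - 1..N + 1}"
    and \<Phi>: "\<Phi> = col_comb (kleene_star (Amat k g)) F \<alpha>"
    by (rule APhi_eigenvector_is_col_comb)
  show "\<exists>v \<in> max_lin_combs (kleene_star (mp_submatrix (Amat k g) (-N - 1) (N + 1)))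
      (critical_nodes (Amat k g) \<inter> {-N - 1..N + 1}). extends_on \<Phi> v (-N - 1) (N + 1)"
    using extension_of_col_comb[OF F, of \<alpha>] F \<Phi> unfolding max_lin_combs_def by blast
qed auto

end

lemma APhi_eigenvectors_nonempty_imp_critical_weight:
  assumes "finite_support_weight g N" "APhi_eigenvectors k (Amat k g) \<noteq> {}"
  shows "critical_weight k g N"
proof -
  interpret finite_support_weight k g N by fact
  obtain \<phi> where "maxplus_eigen k g \<phi>" "tail_cond k \<phi>"
    using assms(2) by (auto simp: APhi_eigenvectors_Amat)
  then show ?thesis by unfold_locales (auto intro: eigen_cycle_le eigen_cycle_attained)
qed

section \<open>Greatest cycle weights for \<open>gam\<close> and \<open>del\<close>\<close>

text \<open>Pull \<open>u i\<close> out of the first minimum and \<open>- u i\<close> out of the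
  second. The correction term vanishes when the preceding pair sum is at most 1.\<close>

lemma gam_cycle:
  "gam u i + gam u (i + 1) = min (u i + u (i + 1)) 1 + min 0 (1 - (u (i - 1) + u i))"
  by (simp add: gam_def min_def)

lemma del_cycle:
  "del u i + del u (i + 1) = min (u (i - 1) + u i) 1 + min 0 (1 - (u i + u (i + 1)))"
  by (simp add: del_def min_def)

context
  fixes u :: "int \<Rightarrow> real" and N :: int
  assumes u_right: "\<forall>i\<ge>N. u i = 0" and u_left: "\<forall>i\<le>-N. u i = 0"
begin

text \<open>Makes the \<open>Max\<close> over an infinite index set a genuine maximum.\<close>

lemma finite_range_pair_sum: "finite (range (\<lambda>i. u (i - 1) + u i))"
proof (rule finite_subset)
  show "range (\<lambda>i. u (i - 1) + u i) \<subseteq> insert 0 ((\<lambda>i. u (i - 1) + u i) ` {-N..N + 1})"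
  proof clarify
    fix i assume "u (i - 1) + u i \<notin> (\<lambda>i. u (i - 1) + u i) ` {-N..N + 1}"
    then have "i \<notin> {-N..N + 1}" by blast
    then show "u (i - 1) + u i = 0" using u_right u_left by auto
  qed
qed simp

lemma pair_sum_le_Max: "u (i - 1) + u i \<le> Max (range (\<lambda>i. u (i - 1) + u i))"
  by (rule Max_ge[OF finite_range_pair_sum]) auto

lemma Max_pair_sum_attained:
  obtains m where "u (m - 1) + u m = Max (range (\<lambda>i. u (i - 1) + u i))"
  using Max_in[OF finite_range_pair_sum] by auto

text \<open>The pair sums are 0 far to the left, so they must cross the level 1 to exceed it. At the
  crossing \<open>gam_cycle\<close> gives exactly 1.\<close>

lemma pair_sum_upcrossing:
  assumes "u (m - 1) + u m > 1"
  shows "\<exists>i. u (i - 1) + u i \<le> 1 \<and> u i + u (i + 1) > 1"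
proof (rule ccontr)
  assume c: "\<not> ?thesis"
  \<comment> \<open>The induction starts where both terms vanish, and not to the right of
    \<open>m\<close>, so that it reaches \<open>m\<close>.\<close>
  have "u (j - 1) + u j \<le> 1" if "min (-N) m \<le> j" for j
    using that
  proof (induction j rule: int_ge_induct)
    case base then show ?case using u_left by simp
  next
    case (step j) then show ?case using c by (auto simp: not_less)
  qed
  then show False using assms by (meson min.cobounded2 not_less)
qed

lemma pair_sum_downcrossing:
  assumes "u (m - 1) + u m > 1"
  shows "\<exists>i. u (i - 1) + u i > 1 \<and> u i + u (i + 1) \<le> 1"
proof (rule ccontr)
  assume c: "\<not> ?thesis"
  have "u (j - 1) + u j \<le> 1" if "j \<le> max (N + 1) m" for j
    using that
  proof (induction j rule: int_le_induct)
    case base then show ?case using u_right by simp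
  next
    case (step j)
    have "\<not> (u (j - 1 - 1) + u (j - 1) > 1 \<and> u (j - 1) + u (j - 1 + 1) \<le> 1)" using c by blast
    then show ?case using step by simp
  qed
  then show False using assms by (meson max.cobounded2 not_less)
qed

lemma gam_cycle_le: "gam u i + gam u (i + 1) \<le> min (Max (range (\<lambda>i. u (i - 1) + u i))) 1"
  using pair_sum_le_Max[of "i + 1"] unfolding gam_cycle by (auto simp: min_def)

lemma del_cycle_le: "del u i + del u (i + 1) \<le> min (Max (range (\<lambda>i. u (i - 1) + u i))) 1"
  using pair_sum_le_Max[of i] unfolding del_cycle by (auto simp: min_def)

lemma gam_cycle_attained:
  "\<exists>i. gam u i + gam u (i + 1) = min (Max (range (\<lambda>i. u (i - 1) + u i))) 1"
proof -
  obtain m where m: "u (m - 1) + u m = Max (range (\<lambda>i. u (i - 1) + u i))"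
    by (rule Max_pair_sum_attained)
  show ?thesis
  proof (cases "u (m - 1) + u m > 1")
    case True
    from pair_sum_upcrossing[OF this] obtain i where "u (i - 1) + u i \<le> 1" "u i + u (i + 1) > 1"
      by blast
    then have "gam u i + gam u (i + 1) = 1" unfolding gam_cycle by simp
    then show ?thesis using True m by (metis less_imp_le min.absorb2)
  next
    case False
    \<comment> \<open>For \<open>gam\<close> the leading pair of cycle \<open>i\<close> is
      \<open>(i, i + 1)\<close>, hence the shift to \<open>m - 1\<close>; for \<open>del\<close> it
      is \<open>(i - 1, i)\<close>.\<close>
    then have "gam u (m - 1) + gam u (m - 1 + 1) = u (m - 1) + u m"
      unfolding gam_cycle using pair_sum_le_Max[of "m - 1"] m by simp
    then show ?thesis using False m by (metis not_less min.absorb1)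
  qed
qed

lemma del_cycle_attained:
  "\<exists>i. del u i + del u (i + 1) = min (Max (range (\<lambda>i. u (i - 1) + u i))) 1"
proof -
  obtain m where m: "u (m - 1) + u m = Max (range (\<lambda>i. u (i - 1) + u i))"
    by (rule Max_pair_sum_attained)
  show ?thesis
  proof (cases "u (m - 1) + u m > 1")
    case True
    from pair_sum_downcrossing[OF this] obtain i where "u (i - 1) + u i > 1" "u i + u (i + 1) \<le> 1"
      by blast
    then have "del u i + del u (i + 1) = 1" unfolding del_cycle by simp
    then show ?thesis using True m by (metis less_imp_le min.absorb2)
  next
    case False
    then have "del u m + del u (m + 1) = u (m - 1) + u m"
      unfolding del_cycle using pair_sum_le_Max[of "m + 1"] m by simp
    then show ?thesis using False m by (metis not_less min.absorb1)
  qed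
qed

end

theorem theorem2p8:
  fixes u :: "int \<Rightarrow> real" and N :: int and k :: real and A :: mp_mat
  assumes "N \<ge> 0"
    and "\<forall>i\<ge>N. u i = 0"
    and "\<forall>i\<le>-N. u i = 0"
    and "A = Amat k (gam u) \<or> A = Amat k (del u)"
  shows "(APhi_eigenvectors k A \<noteq> {} \<longleftrightarrow>
            k = min (Max (range (\<lambda>i. u (i - 1) + u i))) 1) \<and>
         (k = min (Max (range (\<lambda>i. u (i - 1) + u i))) 1 \<longrightarrow>
            APhi_eigenvectors k A = max_lin_combs (kleene_star A) (critical_nodes A) \<and>
            (k \<noteq> 0 \<longrightarrow> critical_nodes A \<subseteq> {-N-1..N+1}) \<and>
            APhi_eigenvectors k A =
              {\<Phi> \<in> APhi_eigenvectors k A.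
                 \<exists>v \<in> max_lin_combs (kleene_star (mp_submatrix A (-N-1) (N+1)))
                        (critical_nodes A \<inter> {-N-1..N+1}).
                   extends_on \<Phi> v (-N-1) (N+1)} \<and>
            (\<forall>F \<alpha>. finite F \<and> F \<noteq> {} \<and> F \<subseteq> critical_nodes A \<inter> {-N-1..N+1} \<longrightarrow>
               {\<Phi> \<in> APhi_eigenvectors k A.
                  extends_on \<Phi>
                    (col_comb (kleene_star (mp_submatrix A (-N-1) (N+1))) F \<alpha>)
                    (-N-1) (N+1)}
               = {col_comb (kleene_star A) F \<alpha>}))"
proof -
  let ?K = "min (Max (range (\<lambda>i. u (i - 1) + u i))) 1"
  obtain g where g: "g = gam u \<or> g = del u" and A: "A = Amat k g" using assms(4) by blast
  have fin: "finite_support_weight g N"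
    using assms(1-3) g by unfold_locales (auto simp: gam_def del_def)
  have le: "g i + g (i + 1) \<le> ?K" for i
    using g gam_cycle_le[OF assms(2,3)] del_cycle_le[OF assms(2,3)] by auto
  have attained: "\<exists>i. g i + g (i + 1) = ?K"
    using g gam_cycle_attained[OF assms(2,3)] del_cycle_attained[OF assms(2,3)] by auto
  have crit: "critical_weight k g N" if "k = ?K"
    using fin le attained that unfolding critical_weight_def critical_weight_axioms_def by blast
  \<comment> \<open>Both \<open>k\<close> and \<open>?K\<close> are the greatest value of
    \<open>g i + g (i + 1)\<close>.\<close>
  have "k = ?K" if "critical_weight k g N"
    using critical_weight.cycle_le[OF that] critical_weight.cycle_attained[OF that] le attained
    by (metis order.antisym)
  then have "APhi_eigenvectors k A \<noteq> {} \<longleftrightarrow> k = ?K"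
    using crit A fin critical_weight.APhi_eigenvectors_nonempty
      APhi_eigenvectors_nonempty_imp_critical_weight by blast
  then show ?thesis
    using critical_weight.APhi_eigenvectors_eq_max_lin_combs[OF crit]
      critical_weight.critical_nodes_bounded[OF crit]
      critical_weight.APhi_eigenvectors_as_extensions[OF crit]
      critical_weight.extension_of_col_comb[OF crit]
    unfolding A by blast
qed

end
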